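(* Let $\mathscr C$ be a closed function clone with domain $C$ which contains $\mathscr O^{(1)}_C$, the set of all unary functions $C\to C$. Then $\mathscr C$ has automatic homeomorphicity, i.e. every clone isomorphism between $\mathscr C$ and a closed subclone of $\mathbf O$ is a homeomorphism. In particular, $\mathbf O$ and $\mathbf O^{(1)}$ have automatic homeomorphicity.
   Context: For a set $D$, $\mathscr O_D$ denotes the set of all operations $D^n\to D$, $n\ge1$. A function clone with domain $D$ is a subset of $\mathscr O_D$ containing all projections $\pi^n_k(x_1,\dots,x_n)=x_k$ and closed under composition $f(g_1,\dots,g_n)$ ($f$ $n$-ary, all $g_i$ $m$-ary). $\mathscr O_D$ carries the topology of pointwise convergence: for each $n$ the set of $n$-ary operations is clopen, and a subbasis is given by the sets $\{f\colon D^n\to D \mid f(a_1,\dots,a_n)=a_0\}$; function clones carry the subspace topology, and a function clone is closed if it is closed in $\mathscr O_D$. $\mathbf O$ denotes $\mathscr O_D$ for a countably infinite set $D$, with this topology, and $\mathbf O^{(1)}$ the monoid of all unary functions on a countably infinite set with the topology of pointwise convergence; a closed subclone of $\mathbf O$ is a closed function clone on a countably infinite set. A clone homomorphism between function clones is a map preserving arities, sending each projection $\pi^n_k$ to the corresponding projection $\pi^n_k$, and satisfying $\xi(f(g_1,\dots,g_n))=\xi(f)(\xi(g_1),\dots,\xi(g_n))$; an isomorphism is a bijective homomorphism. For monoids, the notion is analogous: a closed submonoid $M$ of $\mathbf O^{(1)}$ has automatic homeomorphicity if every monoid isomorphism between $M$ and a closed submonoid of $\mathbf O^{(1)}$ is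 a homeomorphism. *)

theory Defs
  imports "HOL-Analysis.Analysis" "HOL-Algebra.Group"
begin

text \<open>
  An \<open>n\<close>-tuple over \<open>D\<close> is an extensional function on \<open>{..<n}\<close>. An \<open>n\<close>-ary operation on \<open>D\<close> is a
  pair \<open>(n, f)\<close>, where \<open>f\<close> is extensional on the \<open>n\<close>-tuples; the explicit arity keeps operations of
  different arities apart even if their graphs coincide (as for empty \<open>D\<close>). Coordinates are counted
  from \<open>0\<close>.
\<close>

type_synonym 'a operation = "nat \<times> ((nat \<Rightarrow> 'a) \<Rightarrow> 'a)"

abbreviation arity :: "'a operation \<Rightarrow> nat" where
  "arity \<equiv> fst"

abbreviation app :: "'a operation \<Rightarrow> (nat \<Rightarrow> 'a) \<Rightarrow> 'a" where
  "app \<equiv> snd"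

definition tuples :: "'a set \<Rightarrow> nat \<Rightarrow> (nat \<Rightarrow> 'a) set" where
  "tuples D n = {..<n} \<rightarrow>\<^sub>E D"

definition nary_operations :: "'a set \<Rightarrow> nat \<Rightarrow> 'a operation set" where
  "nary_operations D n = {n} \<times> (tuples D n \<rightarrow>\<^sub>E D)"

definition operations :: "'a set \<Rightarrow> 'a operation set" where
  "operations D = (\<Union>n\<in>{1..}. nary_operations D n)"

definition projection :: "'a set \<Rightarrow> nat \<Rightarrow> nat \<Rightarrow> 'a operation" where
  "projection D n k = (n, \<lambda>x\<in>tuples D n. x k)"

definition composition ::
    "'a set \<Rightarrow> nat \<Rightarrow> 'a operation \<Rightarrow> (nat \<Rightarrow> 'a operation) \<Rightarrow> 'a operation" where
  "composition D m f g = (m, \<lambda>x\<in>tuples D m. app f (\<lambda>i\<in>{..<arity f}. app (g i) x))"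

definition function_clone :: "'a set \<Rightarrow> 'a operation set \<Rightarrow> bool" where
  "function_clone D \<C> \<longleftrightarrow>
     \<C> \<subseteq> operations D \<and>
     (\<forall>n\<ge>1. \<forall>k<n. projection D n k \<in> \<C>) \<and>
     (\<forall>f\<in>\<C>. \<forall>m\<ge>1. \<forall>g. (\<forall>i<arity f. g i \<in> \<C> \<and> arity (g i) = m) \<longrightarrow> composition D m f g \<in> \<C>)"

text \<open>
  Pointwise convergence for discrete \<open>D\<close> is the product topology on the \<open>n\<close>-ary operations; the
  topological sum over all arities makes each set of \<open>n\<close>-ary operations clopen.
\<close>

definition operations_topology :: "'a set \<Rightarrow> 'a operation topology" where
  "operations_topology D =
     sum_topology (\<lambda>n. product_topology (\<lambda>_. discrete_topology D) (tuples D n)) {1..}"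

lemma topspace_operations_topology [simp]: "topspace (operations_topology D) = operations D"
  by (auto simp: operations_topology_def operations_def nary_operations_def)

lemma operations_topology_subbasis:
  "operations_topology D = topology_generated_by
     ({nary_operations D n |n. n \<ge> 1} \<union>
      {{f \<in> nary_operations D n. app f a = b} |n a b. n \<ge> 1 \<and> a \<in> tuples D n \<and> b \<in> D})"
    (is "_ = topology_generated_by ?S")
proof -
  let ?P = "\<lambda>n. product_topology (\<lambda>_. discrete_topology D) (tuples D n)"
  have "openin (operations_topology D) s" if s: "s \<in> ?S" for s
  proof -
    have proj_open: "openin (?P n) {g \<in> tuples D n \<rightarrow>\<^sub>E D. g a = b}"
      if "a \<in> tuples D n" "b \<in> D" for n a b
      using openin_continuous_map_preimage[OF continuous_map_product_projection[OF that(1)], of "\<lambda>_. discrete_topology D" "{b}"]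
        that(2) by simp
    have all_open: "openin (?P n) (tuples D n \<rightarrow>\<^sub>E D)" for n
      using openin_topspace[of "?P n"] by simp
    consider n where "n \<ge> 1" "s = nary_operations D n"
      | n a b where "n \<ge> 1" "a \<in> tuples D n" "b \<in> D" "s = {f \<in> nary_operations D n. app f a = b}"
      using s by blast
    then show ?thesis
    proof cases
      case 1
      then have "{x. (i, x) \<in> s} = (if i = n then tuples D n \<rightarrow>\<^sub>E D else {})" for i
        by (auto simp: nary_operations_def)
      with 1 all_open show ?thesis
        unfolding operations_topology_def openin_sum_topology
        by (auto simp: nary_operations_def)
    next
      case 2
      then have "{x. (i, x) \<in> s} = (if i = n then {g \<in> tuples D n \<rightarrow>\<^sub>E D. g a = b} else {})" for i
        by (auto simp: nary_operations_def)
      with 2 proj_open show ?thesis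
        unfolding operations_topology_def openin_sum_topology
        by (auto simp: nary_operations_def)
    qed
  qed
  then have 1: "openin (operations_topology D) U" if "openin (topology_generated_by ?S) U" for U
    using that generate_topology_on_coarsest[of "openin (operations_topology D)" ?S U]
    by (simp add: openin_topology_generated_by_iff)
  have 2: "openin (topology_generated_by ?S) U" if U: "openin (operations_topology D) U" for U
  proof (subst openin_subopen, intro ballI)
    fix p assume p: "p \<in> U"
    obtain n f where pnf: "p = (n, f)" by (cases p)
    have n: "n \<ge> 1" and f: "f \<in> tuples D n \<rightarrow>\<^sub>E D"
      using U[THEN openin_subset] p by (auto simp: pnf operations_def nary_operations_def)
    have "openin (?P n) {x. (n, x) \<in> U}"
      using U n unfolding operations_topology_def openin_sum_topology by simp
    then obtain X where X: "f \<in> Pi\<^sub>E (tuples D n) X" "finite {a. X a \<noteq> D}"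
        "Pi\<^sub>E (tuples D n) X \<subseteq> {x. (n, x) \<in> U}"
      using product_topology_open_contains_basis[of "\<lambda>_. discrete_topology D" "tuples D n" "{x. (n, x) \<in> U}" f] p
      unfolding pnf topspace_discrete_topology mem_Collect_eq by blast
    define F where "F = {a \<in> tuples D n. X a \<noteq> D}"
    define \<V> where "\<V> = insert (nary_operations D n)
                          ((\<lambda>a. {g \<in> nary_operations D n. app g a = f a}) ` F)"
    have "finite \<V>"
      using X(2) by (auto simp: \<V>_def F_def)
    moreover have "openin (topology_generated_by ?S) V" if "V \<in> \<V>" for V
    proof (rule topology_generated_by_Basis)
      show "V \<in> ?S" using that n f unfolding \<V>_def F_def by blast
    qed
    ultimately have "openin (topology_generated_by ?S) (\<Inter>\<V>)"
      by (intro openin_Inter) (auto simp: \<V>_def)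
    moreover have "p \<in> \<Inter>\<V>"
      using f by (auto simp: \<V>_def pnf nary_operations_def)
    moreover have "\<Inter>\<V> \<subseteq> U"
    proof
      fix q assume q: "q \<in> \<Inter>\<V>"
      then obtain g where g: "q = (n, g)" "g \<in> tuples D n \<rightarrow>\<^sub>E D"
        by (auto simp: \<V>_def nary_operations_def)
      have "g a \<in> X a" if "a \<in> tuples D n" for a
      proof (cases "X a = D")
        case False
        then have "g a = f a"
          using q that by (auto simp: \<V>_def F_def g(1))
        then show ?thesis using X(1) that by auto
      qed (use g(2) that in auto)
      then have "g \<in> Pi\<^sub>E (tuples D n) X"
        using g(2) by (auto simp: PiE_iff)
      then show "q \<in> U" using X(3) g(1) by auto
    qed
    ultimately show "\<exists>T. openin (topology_generated_by ?S) T \<and> p \<in> T \<and> T \<subseteq> U"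
      by blast
  qed
  show ?thesis
    using 1 2 by (auto simp: topology_eq)
qed

definition closed_function_clone :: "'a set \<Rightarrow> 'a operation set \<Rightarrow> bool" where
  "closed_function_clone D \<C> \<longleftrightarrow> function_clone D \<C> \<and> closedin (operations_topology D) \<C>"

definition clone_topology :: "'a set \<Rightarrow> 'a operation set \<Rightarrow> 'a operation topology" where
  "clone_topology D \<C> = subtopology (operations_topology D) \<C>"

definition clone_hom ::
    "'a set \<Rightarrow> 'a operation set \<Rightarrow> 'b set \<Rightarrow> 'b operation set \<Rightarrow> ('a operation \<Rightarrow> 'b operation) \<Rightarrow> bool" where
  "clone_hom C \<C> D \<D> \<xi> \<longleftrightarrow>
     \<xi> \<in> \<C> \<rightarrow> \<D> \<and>
     (\<forall>f\<in>\<C>. arity (\<xi> f) = arity f) \<and>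
     (\<forall>n\<ge>1. \<forall>k<n. \<xi> (projection C n k) = projection D n k) \<and>
     (\<forall>f\<in>\<C>. \<forall>m\<ge>1. \<forall>g. (\<forall>i<arity f. g i \<in> \<C> \<and> arity (g i) = m) \<longrightarrow>
        \<xi> (composition C m f g) = composition D m (\<xi> f) (\<lambda>i. \<xi> (g i)))"

definition clone_iso ::
    "'a set \<Rightarrow> 'a operation set \<Rightarrow> 'b set \<Rightarrow> 'b operation set \<Rightarrow> ('a operation \<Rightarrow> 'b operation) \<Rightarrow> bool" where
  "clone_iso C \<C> D \<D> \<xi> \<longleftrightarrow> clone_hom C \<C> D \<D> \<xi> \<and> bij_betw \<xi> \<C> \<D>"

text \<open>
  In the two definitions of automatic homeomorphicity, \<open>D\<close> is the domain of the target structures;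
  it is meant to be countably infinite.
\<close>

definition clone_automatic_homeomorphicity ::
    "'b set \<Rightarrow> 'a set \<Rightarrow> 'a operation set \<Rightarrow> bool" where
  "clone_automatic_homeomorphicity D C \<C> \<longleftrightarrow>
     (\<forall>\<D> \<xi>. closed_function_clone D \<D> \<and> clone_iso C \<C> D \<D> \<xi> \<longrightarrow>
        homeomorphic_map (clone_topology C \<C>) (clone_topology D \<D>) \<xi>)"

definition transformation_monoid :: "'a set \<Rightarrow> ('a \<Rightarrow> 'a) monoid" where
  "transformation_monoid D = \<lparr>carrier = D \<rightarrow>\<^sub>E D, mult = compose D, one = \<lambda>x\<in>D. x\<rparr>"

definition transformation_topology :: "'a set \<Rightarrow> ('a \<Rightarrow> 'a) topology" where
  "transformation_topology D = product_topology (\<lambda>_. discrete_topology D) D"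

definition closed_transformation_monoid :: "'a set \<Rightarrow> ('a \<Rightarrow> 'a) set \<Rightarrow> bool" where
  "closed_transformation_monoid D M \<longleftrightarrow>
     submonoid M (transformation_monoid D) \<and> closedin (transformation_topology D) M"

text \<open>
  The library's \<open>iso\<close> does not mention units; their preservation is automatic for bijective
  homomorphisms of monoids.
\<close>

definition monoid_automatic_homeomorphicity :: "'b set \<Rightarrow> 'a set \<Rightarrow> ('a \<Rightarrow> 'a) set \<Rightarrow> bool" where
  "monoid_automatic_homeomorphicity D C M \<longleftrightarrow>
     (\<forall>N. closed_transformation_monoid D N \<longrightarrow>
       (\<forall>\<xi> \<in> iso (transformation_monoid C\<lparr>carrier := M\<rparr>) (transformation_monoid D\<lparr>carrier := N\<rparr>).
          homeomorphic_map (subtopology (transformation_topology C) M)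
                           (subtopology (transformation_topology D) N) \<xi>))"

end

theory Submission
  imports Defs
begin

text \<open>
  A homomorphism from the monoid of all maps \<open>C \<rightarrow> C\<close> to maps \<open>E \<rightarrow> E\<close> is an action of that monoid
  on \<open>E\<close>. Two facts about such actions carry the whole proof.

  Continuity comes from finite supports. A set \<open>A \<subseteq> C\<close> supports \<open>y \<in> E\<close> if the value \<open>p \<cdot> y\<close> depends
  only on the restriction of \<open>p\<close> to \<open>A\<close>. Intersections of two supports are supports, because two
  maps that agree on \<open>A \<inter> B\<close> are linked by a map that agrees with the first on \<open>A\<close> and with the
  second on \<open>B\<close>; and supports are transported along the action. If \<open>C\<close> is countably infinite, there
  is an uncountable family of injections \<open>C \<rightarrow> C\<close> whose images intersect pairwise in finite sets.
  As \<open>E\<close> is countable, two members \<open>f \<noteq> g\<close> of the family satisfy \<open>f \<cdot> y = g \<cdot> y\<close>. This point is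
  supported by the image of \<open>f\<close> and by the image of \<open>g\<close>, hence by their finite intersection, and a
  left inverse of \<open>f\<close> carries that to a finite support of \<open>y\<close> (lemma \<open>finite_support\<close>).

  Openness comes from the constant maps. As distinct maps act differently, for a suitable \<open>x \<in> E\<close> the map \<open>\<phi>\<close> sending \<open>a \<in> C\<close> to
  \<open>const a \<cdot> x\<close> is injective (lemma \<open>faithful_imp_constants_separated\<close>), and \<open>u \<cdot> \<phi> a = \<phi> (u a)\<close>:
  a copy of the natural action on \<open>C\<close> sits inside \<open>E\<close>, and \<open>u a\<close> can be read off from the value of
  the image of \<open>u\<close> at the single point \<open>\<phi> a\<close>. In particular \<open>C\<close> is countable, so the first part
  applies to every infinite \<open>C\<close>; on a finite \<open>C\<close>, the set \<open>C\<close> itself is a finite support.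

  Both facts pass from unary to \<open>n\<close>-ary operations \<open>f\<close> of a clone by composing with unary ones.
  The identity \<open>f (const a\<^sub>1, \<dots>, const a\<^sub>n) = const (f a)\<close> shows that \<open>\<phi>\<close> is also compatible with
  \<open>f\<close> (lemma \<open>hom_act_constants\<close>). If \<open>u\<^sub>i\<close> has finite range and is the identity on a finite support
  of \<open>y\<^sub>i\<close>, the image of \<open>f\<close> takes the same value at \<open>(y\<^sub>1, \<dots>, y\<^sub>n)\<close> as the image of
  \<open>f (u\<^sub>1 x\<^sub>1, \<dots>, u\<^sub>n x\<^sub>n)\<close>, and the latter operation is determined by the finitely many values of
  \<open>f\<close> on the product of the ranges (lemma \<open>hom_locally_determined\<close>).
\<close>

section \<open>Actions of the full transformation monoid\<close>

locale transformation_action =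
  fixes C :: "'c set" and E :: "'e set" and act :: "('c \<Rightarrow> 'c) \<Rightarrow> 'e \<Rightarrow> 'e"
  assumes act_closed: "\<lbrakk>u \<in> C \<rightarrow>\<^sub>E C; x \<in> E\<rbrakk> \<Longrightarrow> act u x \<in> E"
    and act_compose: "\<lbrakk>u \<in> C \<rightarrow>\<^sub>E C; v \<in> C \<rightarrow>\<^sub>E C; x \<in> E\<rbrakk> \<Longrightarrow> act (compose C u v) x = act u (act v x)"
begin

definition supports :: "'c set \<Rightarrow> 'e \<Rightarrow> bool" where
  "supports A y \<longleftrightarrow>
     (\<forall>p \<in> C \<rightarrow>\<^sub>E C. \<forall>q \<in> C \<rightarrow>\<^sub>E C. (\<forall>a\<in>A. p a = q a) \<longrightarrow> act p y = act q y)"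

lemma supports_domain: "supports C y"
  unfolding supports_def
proof (intro ballI impI)
  fix p q assume "p \<in> C \<rightarrow>\<^sub>E C" "q \<in> C \<rightarrow>\<^sub>E C" "\<forall>a\<in>C. p a = q a"
  then have "p = q" by (intro PiE_ext) auto
  then show "act p y = act q y" by simp
qed

lemma supports_image:
  assumes "v \<in> C \<rightarrow>\<^sub>E C" "y \<in> E" "A \<subseteq> C" "supports A y"
  shows "supports (v ` A) (act v y)"
  unfolding supports_def
proof (intro ballI impI)
  fix p q assume pq: "p \<in> C \<rightarrow>\<^sub>E C" "q \<in> C \<rightarrow>\<^sub>E C" "\<forall>a\<in>v ` A. p a = q a"
  have "compose C p v \<in> C \<rightarrow>\<^sub>E C" "compose C q v \<in> C \<rightarrow>\<^sub>E C"
    using assms(1) pq by (auto simp: compose_def)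
  moreover have "\<forall>a\<in>A. compose C p v a = compose C q v a"
    using pq(3) assms(3) by (auto simp: compose_def)
  ultimately have "act (compose C p v) y = act (compose C q v) y"
    using assms(4) unfolding supports_def by blast
  then show "act p (act v y) = act q (act v y)"
    using act_compose assms(1,2) pq by simp
qed

lemma supports_Int:
  assumes "supports A y" "supports B y"
  shows "supports (A \<inter> B) y"
  unfolding supports_def
proof (intro ballI impI)
  fix p q assume pq: "p \<in> C \<rightarrow>\<^sub>E C" "q \<in> C \<rightarrow>\<^sub>E C" "\<forall>a\<in>A \<inter> B. p a = q a"
  (* h interpolates: it is p on A, and q on B because p and q agree on the overlap. *)
  define h where "h = (\<lambda>c. if c \<in> A then p c else q c)"
  have "h \<in> C \<rightarrow>\<^sub>E C"
    using pq(1,2) by (auto simp: h_def PiE_iff extensional_def)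
  moreover have "\<forall>a\<in>A. p a = h a" "\<forall>a\<in>B. h a = q a"
    using pq(3) by (auto simp: h_def)
  ultimately have "act p y = act h y" "act h y = act q y"
    using assms pq(1,2) unfolding supports_def by blast+
  then show "act p y = act q y" by simp
qed

text \<open>
  Since \<open>p \<circ> l \<circ> f = p\<close>, acting by \<open>p\<close> on \<open>y\<close> is the same as acting by \<open>p\<close> on \<open>l \<cdot> (f \<cdot> y)\<close>, and
  \<open>l\<close> transports the support of \<open>f \<cdot> y\<close> to that point.
\<close>

lemma supports_left_inverse:
  assumes "f \<in> C \<rightarrow>\<^sub>E C" "l \<in> C \<rightarrow>\<^sub>E C" "\<And>c. c \<in> C \<Longrightarrow> l (f c) = c"
    and "y \<in> E" "A \<subseteq> C" "supports A (act f y)"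
  shows "supports (l ` A) y"
proof -
  have "act p (act l (act f y)) = act p y" if p: "p \<in> C \<rightarrow>\<^sub>E C" for p
  proof -
    have pl: "compose C p l \<in> C \<rightarrow>\<^sub>E C"
      using p assms(2) by (auto simp: compose_def)
    have "compose C (compose C p l) f = p"
    proof (rule PiE_ext)
      show "compose C (compose C p l) f \<in> C \<rightarrow>\<^sub>E C"
        using pl assms(1) by (auto simp: compose_def)
      show "p \<in> C \<rightarrow>\<^sub>E C" by (rule p)
      show "compose C (compose C p l) f c = p c" if "c \<in> C" for c
        using that assms(1,3) PiE_mem[OF assms(1) that] by (simp add: compose_def)
    qed
    then show ?thesis
      using act_compose[OF pl assms(1,4)] act_compose[OF p assms(2) act_closed[OF assms(1,4)]]
      by simp
  qed
  moreover have "supports (l ` A) (act l (act f y))"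
    using supports_image[OF assms(2) act_closed[OF assms(1,4)] assms(5,6)] .
  ultimately show ?thesis
    unfolding supports_def by metis
qed

end

text \<open>
  The branches of the binary tree: the injection for \<open>s\<close> sends the \<open>k\<close>-th element of \<open>C\<close> to (a code
  of) the initial segment of \<open>s\<close> of length \<open>k\<close>. Distinct branches share only the finitely many
  segments before the place where they part.
\<close>

lemma almost_disjoint_injections:
  fixes C :: "'c set"
  assumes "countable C" "infinite C"
  shows "\<exists>F :: (nat \<Rightarrow> bool) \<Rightarrow> 'c \<Rightarrow> 'c.
    (\<forall>s. F s \<in> C \<rightarrow>\<^sub>E C \<and> inj_on (F s) C) \<and>
    (\<forall>s t. s \<noteq> t \<longrightarrow> finite (F s ` C \<inter> F t ` C))"
proof -
  define node :: "bool list \<Rightarrow> 'c" where "node l = from_nat_into C (to_nat l)" for l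
  have node_in: "node l \<in> C" for l
    unfolding node_def using assms(2) by (intro from_nat_into) auto
  have node_inj: "node l = node l' \<Longrightarrow> l = l'" for l l'
    unfolding node_def using from_nat_into_inj_infinite[OF assms] by simp
  define F where "F s = (\<lambda>c\<in>C. node (map s [0..<to_nat_on C c]))" for s
  have index: "to_nat_on C c = to_nat_on C d \<and> (\<forall>k<to_nat_on C c. s k = t k)"
    if "c \<in> C" "d \<in> C" "F s c = F t d" for s t c d
  proof -
    have eq: "map s [0..<to_nat_on C c] = map t [0..<to_nat_on C d]"
      using that by (intro node_inj) (simp add: F_def)
    then have "to_nat_on C c = to_nat_on C d"
      by (metis diff_zero length_map length_upt)
    with eq show ?thesis by auto
  qed
  show ?thesis
  proof (intro exI[of _ F] conjI allI impI)
    show "F s \<in> C \<rightarrow>\<^sub>E C" for s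
      using node_in by (auto simp: F_def)
    show "inj_on (F s) C" for s
      using index inj_on_to_nat_on[OF assms(1)] unfolding inj_on_def by blast
    show "finite (F s ` C \<inter> F t ` C)" if "s \<noteq> t" for s t
    proof -
      obtain k where k: "s k \<noteq> t k" using \<open>s \<noteq> t\<close> by blast
      have "F s ` C \<inter> F t ` C \<subseteq> F s ` {c \<in> C. to_nat_on C c \<le> k}"
      proof
        fix b assume "b \<in> F s ` C \<inter> F t ` C"
        then obtain c d where cd: "c \<in> C" "d \<in> C" "b = F s c" "F s c = F t d" by auto
        then have "\<not> k < to_nat_on C c" using index[OF cd(1,2,4)] k by blast
        then show "b \<in> F s ` {c \<in> C. to_nat_on C c \<le> k}" using cd(1,3) by auto
      qed
      moreover have "finite {c \<in> C. to_nat_on C c \<le> k}"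
        by (rule inj_on_finite[of "to_nat_on C" _ "{..k}"])
          (use inj_on_to_nat_on[OF assms(1)] in \<open>auto simp: inj_on_def\<close>)
      ultimately show ?thesis
        by (meson finite_imageI finite_subset)
    qed
  qed
qed

lemma uncountable_sequences_collide:
  fixes h :: "(nat \<Rightarrow> bool) \<Rightarrow> 'a"
  assumes "countable (range h)"
  obtains s t where "s \<noteq> t" "h s = h t"
proof -
  have "\<not> inj h"
  proof
    assume "inj h"
    then have "countable (UNIV :: (nat \<Rightarrow> bool) set)"
      using assms countable_image_inj_on by blast
    then have "range (from_nat_into UNIV) = (UNIV :: (nat \<Rightarrow> bool) set)"
      by (intro range_from_nat_into) auto
    then obtain e :: "nat \<Rightarrow> nat \<Rightarrow> bool" where e: "range e = UNIV" by blast
    obtain n where "(\<lambda>k. \<not> e k k) = e n"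
      using e by (metis UNIV_I rangeE)
    then have "(\<not> e n n) = e n n" by (rule fun_cong)
    then show False by simp
  qed
  then show thesis using that by (auto simp: inj_def)
qed

context transformation_action
begin

text \<open>
  By countability of \<open>E\<close>, two of the almost disjoint injections send \<open>y\<close> to the same point. That
  point is then supported by the finite intersection of their images.
\<close>

lemma finite_support:
  assumes "countable C" "countable E" "y \<in> E"
  obtains A where "finite A" "A \<subseteq> C" "supports A y"
proof (cases "finite C")
  case True
  then show thesis using supports_domain that by blast
next
  case False
  obtain F :: "(nat \<Rightarrow> bool) \<Rightarrow> 'c \<Rightarrow> 'c"
    where "\<forall>s. F s \<in> C \<rightarrow>\<^sub>E C \<and> inj_on (F s) C"
      and "\<forall>s t. s \<noteq> t \<longrightarrow> finite (F s ` C \<inter> F t ` C)"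
    using almost_disjoint_injections[OF assms(1) False] by (elim exE conjE)
  then have F: "\<And>s. F s \<in> C \<rightarrow>\<^sub>E C" "\<And>s. inj_on (F s) C"
    and disjoint: "\<And>s t. s \<noteq> t \<Longrightarrow> finite (F s ` C \<inter> F t ` C)"
    by simp_all
  have "range (\<lambda>s. act (F s) y) \<subseteq> E"
    using act_closed F(1) assms(3) by blast
  then have "countable (range (\<lambda>s. act (F s) y))"
    using assms(2) countable_subset by blast
  then obtain s t where st: "s \<noteq> t" "act (F s) y = act (F t) y"
    by (rule uncountable_sequences_collide)
  define A where "A = F s ` C \<inter> F t ` C"
  have AC: "A \<subseteq> C" using F(1) by (auto simp: A_def PiE_iff)
  have "supports (F r ` C) (act (F r) y)" for r
    using supports_image F(1) assms(3) supports_domain by blast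
  then have A: "supports A (act (F s) y)"
    unfolding A_def using st(2) by (metis supports_Int)
  (* A left inverse of F s, extended by the identity to the rest of C. *)
  define l where "l = (\<lambda>c\<in>C. if c \<in> F s ` C then inv_into C (F s) c else c)"
  have "l \<in> C \<rightarrow>\<^sub>E C"
    using inv_into_into[of _ "F s" C] by (auto simp: l_def)
  moreover have "l (F s c) = c" if "c \<in> C" for c
    using that F(1,2) by (auto simp: l_def PiE_iff)
  ultimately have "supports (l ` A) y"
    using supports_left_inverse[OF F(1) _ _ assms(3) AC A] by blast
  moreover have "l ` A \<subseteq> C" using AC \<open>l \<in> C \<rightarrow>\<^sub>E C\<close> by (auto simp: PiE_iff)
  moreover have "finite (l ` A)" using disjoint[OF st(1)] by (simp add: A_def)
  ultimately show thesis using that by blast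
qed

text \<open>
  If \<open>a \<mapsto> const a \<cdot> x\<close> identifies two distinct points \<open>c\<close> and \<open>d\<close>, acting by a map that sends
  \<open>c\<close> to \<open>a\<close> and \<open>d\<close> to \<open>b\<close> shows that it identifies any \<open>a\<close> and \<open>b\<close>. So it is either injective or
  constant. If \<open>C\<close> has two points, it cannot be constant for all \<open>x\<close>, because distinct constant
  maps act differently.
\<close>

lemma faithful_imp_constants_separated:
  assumes "E \<noteq> {}"
    and faithful: "\<And>u v. \<lbrakk>u \<in> C \<rightarrow>\<^sub>E C; v \<in> C \<rightarrow>\<^sub>E C; \<And>x. x \<in> E \<Longrightarrow> act u x = act v x\<rbrakk> \<Longrightarrow> u = v"
  obtains x where "x \<in> E" "inj_on (\<lambda>a. act (\<lambda>_\<in>C. a) x) C"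
proof (cases "\<exists>a\<in>C. \<exists>b\<in>C. a \<noteq> b")
  case False
  then have "inj_on (\<lambda>a. act (\<lambda>_\<in>C. a) x) C" for x
    by (auto simp: inj_on_def)
  then show thesis using assms(1) that by blast
next
  case True
  then obtain a b where ab: "a \<in> C" "b \<in> C" "a \<noteq> b" by blast
  then have "(\<lambda>_\<in>C. a) \<noteq> (\<lambda>_\<in>C. b)" by (metis restrict_apply')
  with ab obtain x where x: "x \<in> E" "act (\<lambda>_\<in>C. a) x \<noteq> act (\<lambda>_\<in>C. b) x"
    using faithful[of "\<lambda>_\<in>C. a" "\<lambda>_\<in>C. b"] by auto
  have "inj_on (\<lambda>a. act (\<lambda>_\<in>C. a) x) C"
  proof (rule inj_onI, rule ccontr)
    fix c d assume cd: "c \<in> C" "d \<in> C" "act (\<lambda>_\<in>C. c) x = act (\<lambda>_\<in>C. d) x" "c \<noteq> d"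
    define u where "u = (\<lambda>z\<in>C. if z = c then a else b)"
    have u: "u \<in> C \<rightarrow>\<^sub>E C" using ab by (auto simp: u_def)
    have "act (\<lambda>_\<in>C. u z) x = act u (act (\<lambda>_\<in>C. z) x)" if "z \<in> C" for z
    proof -
      have "compose C u (\<lambda>_\<in>C. z) = (\<lambda>_\<in>C. u z)" by (auto simp: compose_def)
      then show ?thesis using act_compose[OF u _ x(1), of "\<lambda>_\<in>C. z"] that by simp
    qed
    from this[of c] this[of d] show False
      using cd x(2) by (simp add: u_def)
  qed
  then show thesis using x(1) that by blast
qed

end

section \<open>Continuity for pointwise convergence\<close>

lemma openin_pointwise_cylinder:
  assumes "f \<in> S \<rightarrow>\<^sub>E D" "finite A" "A \<subseteq> S"
  shows "openin (product_topology (\<lambda>_. discrete_topology D) S) {g \<in> S \<rightarrow>\<^sub>E D. \<forall>a\<in>A. g a = f a}"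
proof -
  have "{g \<in> S \<rightarrow>\<^sub>E D. \<forall>a\<in>A. g a = f a} = (\<Pi>\<^sub>E a\<in>S. if a \<in> A then {f a} else D)"
  proof (intro subset_antisym subsetI)
    fix g assume "g \<in> {g \<in> S \<rightarrow>\<^sub>E D. \<forall>a\<in>A. g a = f a}"
    then show "g \<in> (\<Pi>\<^sub>E a\<in>S. if a \<in> A then {f a} else D)"
      by (auto simp: PiE_iff)
  next
    fix g assume g: "g \<in> (\<Pi>\<^sub>E a\<in>S. if a \<in> A then {f a} else D)"
    have fixed: "g a = f a" if "a \<in> A" for a
      using PiE_mem[OF g, of a] that assms(3) by auto
    have "g a \<in> D" if "a \<in> S" for a
      using PiE_mem[OF g that] PiE_mem[OF assms(1) that] by (cases "a \<in> A") auto
    with fixed g show "g \<in> {g \<in> S \<rightarrow>\<^sub>E D. \<forall>a\<in>A. g a = f a}"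
      by (simp add: PiE_iff)
  qed
  moreover have "openin (product_topology (\<lambda>_. discrete_topology D) S)
      (\<Pi>\<^sub>E a\<in>S. if a \<in> A then {f a} else D)"
  proof (rule product_topology_basis)
    show "openin (discrete_topology D) (if a \<in> A then {f a} else D)" for a
      using assms(1,3) by (auto simp: PiE_iff)
    show "finite {a. (if a \<in> A then {f a} else D) \<noteq> topspace (discrete_topology D)}"
      by (rule finite_subset[OF _ assms(2)]) auto
  qed
  ultimately show ?thesis by simp
qed

text \<open>
  Continuity in the form in which it is verified below, both for an isomorphism and for its
  inverse: each value of the image is determined by finitely many values of the argument.
\<close>

lemma continuous_map_transformationsI:
  assumes M: "M \<subseteq> C \<rightarrow>\<^sub>E C" and N: "N \<subseteq> D \<rightarrow>\<^sub>E D" and \<xi>: "\<xi> \<in> M \<rightarrow> N"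
    and loc: "\<And>y. y \<in> D \<Longrightarrow> \<exists>A. finite A \<and> A \<subseteq> C \<and>
       (\<forall>f\<in>M. \<forall>g\<in>M. (\<forall>a\<in>A. g a = f a) \<longrightarrow> \<xi> g y = \<xi> f y)"
  shows "continuous_map (subtopology (transformation_topology C) M)
           (subtopology (transformation_topology D) N) \<xi>"
proof -
  have top: "topspace (subtopology (transformation_topology C) M) = M"
    using M by (auto simp: transformation_topology_def)
  have "continuous_map (subtopology (transformation_topology C) M) (discrete_topology D) (\<lambda>f. \<xi> f y)"
    if y: "y \<in> D" for y
    unfolding continuous_map_def top
  proof (intro conjI allI impI)
    show "(\<lambda>f. \<xi> f y) \<in> M \<rightarrow> topspace (discrete_topology D)"
      using \<xi> N y by (auto simp: PiE_iff Pi_iff)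
    fix U assume "openin (discrete_topology D) U"
    obtain A where A: "finite A" "A \<subseteq> C"
      "\<And>f g. f \<in> M \<Longrightarrow> g \<in> M \<Longrightarrow> (\<forall>a\<in>A. g a = f a) \<Longrightarrow> \<xi> g y = \<xi> f y"
      using loc[OF y] by blast
    show "openin (subtopology (transformation_topology C) M) {f \<in> M. \<xi> f y \<in> U}"
    proof (subst openin_subopen, intro ballI)
      fix f assume f: "f \<in> {f \<in> M. \<xi> f y \<in> U}"
      let ?T = "{g \<in> C \<rightarrow>\<^sub>E C. \<forall>a\<in>A. g a = f a} \<inter> M"
      have "openin (subtopology (transformation_topology C) M) ?T"
        unfolding transformation_topology_def
        using f M A(1,2) by (intro openin_subtopology_Int openin_pointwise_cylinder) auto
      moreover have "f \<in> ?T" using f M by auto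
      moreover have "?T \<subseteq> {f \<in> M. \<xi> f y \<in> U}"
      proof
        fix g assume "g \<in> ?T"
        then show "g \<in> {f \<in> M. \<xi> f y \<in> U}" using A(3)[of f g] f by auto
      qed
      ultimately show "\<exists>T. openin (subtopology (transformation_topology C) M) T \<and> f \<in> T
          \<and> T \<subseteq> {f \<in> M. \<xi> f y \<in> U}" by blast
    qed
  qed
  moreover have "\<xi> \<in> M \<rightarrow> extensional D"
    using \<xi> N by (auto simp: PiE_iff)
  ultimately show ?thesis
    using \<xi> unfolding continuous_map_in_subtopology
    by (auto simp: transformation_topology_def[of D] continuous_map_componentwise top)
qed

lemma openin_operations_cylinder:
  assumes "f \<in> nary_operations D n" "n \<ge> 1" "finite A" "A \<subseteq> tuples D n"
  shows "openin (operations_topology D) {g \<in> nary_operations D n. \<forall>a\<in>A. app g a = app f a}"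
proof -
  let ?G = "{g \<in> tuples D n \<rightarrow>\<^sub>E D. \<forall>a\<in>A. g a = app f a}"
  have "{x. (i, x) \<in> {g \<in> nary_operations D n. \<forall>a\<in>A. app g a = app f a}} = (if i = n then ?G else {})" for i
    by (auto simp: nary_operations_def)
  moreover have "openin (product_topology (\<lambda>_. discrete_topology D) (tuples D n)) ?G"
    using assms by (intro openin_pointwise_cylinder) (auto simp: nary_operations_def)
  ultimately show ?thesis
    using assms(2) unfolding operations_topology_def openin_sum_topology
    by (auto simp: nary_operations_def)
qed

lemma operation_cases:
  assumes "f \<in> operations D"
  shows "arity f \<ge> 1" "f \<in> nary_operations D (arity f)"
  using assms by (auto simp: operations_def nary_operations_def)

text \<open>
  The same criterion for operations; the arities have to be respected because each arity is a
  clopen piece of the space.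
\<close>

lemma continuous_map_operationsI:
  assumes \<C>: "\<C> \<subseteq> operations C" and \<D>: "\<D> \<subseteq> operations D" and \<xi>: "\<xi> \<in> \<C> \<rightarrow> \<D>"
    and arity: "\<And>f. f \<in> \<C> \<Longrightarrow> arity (\<xi> f) = arity f"
    and loc: "\<And>n y. \<lbrakk>n \<ge> 1; y \<in> tuples D n\<rbrakk> \<Longrightarrow> \<exists>A. finite A \<and> A \<subseteq> tuples C n \<and>
       (\<forall>f\<in>\<C>. \<forall>g\<in>\<C>. arity f = n \<and> arity g = n \<and> (\<forall>a\<in>A. app g a = app f a)
          \<longrightarrow> app (\<xi> g) y = app (\<xi> f) y)"
  shows "continuous_map (clone_topology C \<C>) (clone_topology D \<D>) \<xi>"
proof -
  have top: "topspace (clone_topology C \<C>) = \<C>"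
    using \<C> by (auto simp: clone_topology_def)
  have cylinder: "openin (clone_topology C \<C>) U"
    if "n \<ge> 1" "finite A" "A \<subseteq> tuples C n" "U \<subseteq> \<C>" "\<And>f. f \<in> U \<Longrightarrow> arity f = n"
      "\<And>f g. \<lbrakk>f \<in> U; g \<in> \<C>; arity g = n; \<forall>a\<in>A. app g a = app f a\<rbrakk> \<Longrightarrow> g \<in> U" for n A U
  proof (subst openin_subopen, intro ballI)
    fix f assume f: "f \<in> U"
    then have fn: "f \<in> nary_operations C n"
      using that(4,5) \<C> operation_cases(2) by (metis subsetD)
    let ?T = "{g \<in> nary_operations C n. \<forall>a\<in>A. app g a = app f a} \<inter> \<C>"
    have "openin (clone_topology C \<C>) ?T"
      unfolding clone_topology_def
      by (intro openin_subtopology_Int openin_operations_cylinder fn that)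
    moreover have "f \<in> ?T" using f fn that(4) by auto
    moreover have "?T \<subseteq> U" using that(6)[OF f] by (auto simp: nary_operations_def)
    ultimately show "\<exists>T. openin (clone_topology C \<C>) T \<and> f \<in> T \<and> T \<subseteq> U" by blast
  qed
  have nary: "\<xi> f \<in> nary_operations D n \<longleftrightarrow> arity f = n" if "f \<in> \<C>" for f n
  proof -
    have "\<xi> f \<in> operations D" using that \<xi> \<D> by auto
    then show ?thesis
      using operation_cases(2)[of "\<xi> f" D] arity[OF that] by (auto simp: nary_operations_def)
  qed
  have "continuous_map (clone_topology C \<C>) (operations_topology D) \<xi>"
    unfolding operations_topology_subbasis
  proof (rule continuous_on_generated_topo)
    fix S assume "S \<in> {nary_operations D n |n. n \<ge> 1} \<union>
      {{f \<in> nary_operations D n. app f a = b} |n a b. n \<ge> 1 \<and> a \<in> tuples D n \<and> b \<in> D}"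
    then consider n where "n \<ge> 1" "S = nary_operations D n"
      | n a b where "n \<ge> 1" "a \<in> tuples D n" "S = {f \<in> nary_operations D n. app f a = b}"
      by blast
    then show "openin (clone_topology C \<C>) (\<xi> -` S \<inter> topspace (clone_topology C \<C>))"
    proof cases
      case 1
      show ?thesis unfolding top
        by (rule cylinder[of n "{}"]) (use 1 nary in auto)
    next
      case 2
      obtain A where A: "finite A" "A \<subseteq> tuples C n"
        "\<And>f g. \<lbrakk>f \<in> \<C>; g \<in> \<C>; arity f = n; arity g = n; \<forall>a\<in>A. app g a = app f a\<rbrakk>
           \<Longrightarrow> app (\<xi> g) a = app (\<xi> f) a"
        using loc[OF 2(1,2)] by blast
      have S: "\<xi> -` S \<inter> \<C> = {f \<in> \<C>. arity f = n \<and> app (\<xi> f) a = b}"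
        using 2(3) nary by auto
      show ?thesis unfolding top S
      proof (rule cylinder[OF 2(1) A(1,2)])
        fix f g
        assume f: "f \<in> {f \<in> \<C>. arity f = n \<and> app (\<xi> f) a = b}"
          and g: "g \<in> \<C>" "arity g = n" "\<forall>a\<in>A. app g a = app f a"
        show "g \<in> {f \<in> \<C>. arity f = n \<and> app (\<xi> f) a = b}"
          using A(3)[of f g] f g by auto
      qed auto
    qed
  next
    have "\<xi> f \<in> nary_operations D (arity f) \<and> arity f \<ge> 1" if "f \<in> \<C>" for f
      using nary[OF that] that \<C> operation_cases(1) by blast
    then show "\<xi> ` topspace (clone_topology C \<C>) \<subseteq> \<Union> ({nary_operations D n |n. n \<ge> 1} \<union>
      {{f \<in> nary_operations D n. app f a = b} |n a b. n \<ge> 1 \<and> a \<in> tuples D n \<and> b \<in> D})"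
      unfolding top by blast
  qed
  then show ?thesis
    using \<xi> unfolding clone_topology_def[of D] continuous_map_in_subtopology top by auto
qed

section \<open>Clone isomorphisms\<close>

definition unary_operation :: "'a set \<Rightarrow> ('a \<Rightarrow> 'a) \<Rightarrow> 'a operation" where
  "unary_operation D u = (1, \<lambda>x\<in>tuples D 1. u (x 0))"

abbreviation singleton_tuple :: "'a \<Rightarrow> nat \<Rightarrow> 'a" where
  "singleton_tuple x \<equiv> (\<lambda>_\<in>{..<Suc 0}. x)"

lemma singleton_tuple_in_tuples [simp]: "singleton_tuple x \<in> tuples D (Suc 0) \<longleftrightarrow> x \<in> D"
  by (auto simp: tuples_def PiE_iff)

lemma arity_unary_operation [simp]: "arity (unary_operation D u) = 1"
  by (simp add: unary_operation_def)

lemma unary_operation_in: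
  "u \<in> D \<rightarrow>\<^sub>E D \<Longrightarrow> unary_operation D u \<in> nary_operations D 1"
  by (auto simp: unary_operation_def nary_operations_def tuples_def PiE_iff)

lemma unary_operation_inject:
  assumes "u \<in> D \<rightarrow>\<^sub>E D" "v \<in> D \<rightarrow>\<^sub>E D" "unary_operation D u = unary_operation D v"
  shows "u = v"
proof (rule PiE_ext[OF assms(1,2)])
  fix x assume "x \<in> D"
  then show "u x = v x"
    using assms(3) singleton_tuple_in_tuples[of x D]
    by (auto simp: unary_operation_def fun_eq_iff restrict_def split: if_splits dest!: spec[of _ "singleton_tuple x"])
qed

lemma unary_tuple_eq: "t \<in> tuples D 1 \<Longrightarrow> t = singleton_tuple (t 0)"
  by (auto simp: tuples_def PiE_iff extensional_def fun_eq_iff)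

lemma unary_operation_eqI:
  assumes "f \<in> nary_operations D 1" "g \<in> nary_operations D 1"
    and "\<And>x. x \<in> D \<Longrightarrow> app f (singleton_tuple x) = app g (singleton_tuple x)"
  shows "f = g"
proof -
  have "app f t = app g t" if "t \<in> tuples D 1" for t
    using assms(3)[of "t 0"] unary_tuple_eq[OF that] that by (auto simp: tuples_def PiE_iff)
  then have "app f = app g"
    using assms(1,2) by (intro PiE_ext[of _ "tuples D 1" "\<lambda>_. D"]) (auto simp: nary_operations_def)
  then show ?thesis
    using assms(1,2) by (auto simp: nary_operations_def prod_eq_iff)
qed

lemma finite_range_map_fixing:
  assumes "finite A" "A \<subseteq> C"
  obtains u where "u \<in> C \<rightarrow>\<^sub>E C" "finite (u ` C)" "\<forall>a\<in>A. u a = a"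
proof (cases "C = {}")
  case True
  then show thesis using that[of "\<lambda>_. undefined"] assms by auto
next
  case False
  then obtain c where c: "c \<in> C" by blast
  have "(\<lambda>z\<in>C. if z \<in> A then z else c) ` C \<subseteq> insert c A" by auto
  then have "finite ((\<lambda>z\<in>C. if z \<in> A then z else c) ` C)"
    using assms(1) finite_subset by blast
  then show thesis
    using c assms(2) by (intro that[of "\<lambda>z\<in>C. if z \<in> A then z else c"]) auto
qed

text \<open>
  On the unary operations a clone isomorphism is an action on \<open>E\<close> of the monoid of all maps
  \<open>C \<rightarrow> C\<close>, which makes the results on supports and constants available.
\<close>

locale full_clone_iso =
  fixes C :: "'c set" and \<C> :: "'c operation set"
    and E :: "'e set" and \<D> :: "'e operation set"
    and \<xi> :: "'c operation \<Rightarrow> 'e operation"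
  assumes clone: "function_clone C \<C>" and unary: "nary_operations C 1 \<subseteq> \<C>"
    and clone': "function_clone E \<D>" and iso: "clone_iso C \<C> E \<D> \<xi>"
begin

definition act :: "('c \<Rightarrow> 'c) \<Rightarrow> 'e \<Rightarrow> 'e" where
  "act u x = app (\<xi> (unary_operation C u)) (singleton_tuple x)"

lemma operations_C: "f \<in> \<C> \<Longrightarrow> f \<in> nary_operations C (arity f)"
  using clone operation_cases[of f C] unfolding function_clone_def by auto

lemma operations_E: "g \<in> \<D> \<Longrightarrow> g \<in> nary_operations E (arity g)"
  using clone' operation_cases[of g E] unfolding function_clone_def by auto

lemma hom: "\<xi> \<in> \<C> \<rightarrow> \<D>" "f \<in> \<C> \<Longrightarrow> arity (\<xi> f) = arity f"
  "\<lbrakk>n \<ge> 1; k < n\<rbrakk> \<Longrightarrow> \<xi> (projection C n k) = projection E n k"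
  using iso unfolding clone_iso_def clone_hom_def by blast+

lemma app_hom_composition:
  assumes "f \<in> \<C>" "m \<ge> 1" "y \<in> tuples E m"
    and "\<And>i. i < arity f \<Longrightarrow> g i \<in> \<C> \<and> arity (g i) = m"
  shows "app (\<xi> (composition C m f g)) y = app (\<xi> f) (\<lambda>i\<in>{..<arity f}. app (\<xi> (g i)) y)"
proof -
  have "\<xi> (composition C m f g) = composition E m (\<xi> f) (\<lambda>i. \<xi> (g i))"
    using iso assms unfolding clone_iso_def clone_hom_def by blast
  then show ?thesis using assms hom(2) by (simp add: composition_def)
qed

lemma unary_in: "u \<in> C \<rightarrow>\<^sub>E C \<Longrightarrow> unary_operation C u \<in> \<C>"
  using unary unary_operation_in by blast

lemma projection_in: "k < n \<Longrightarrow> projection C n k \<in> \<C>"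
  using clone unfolding function_clone_def by force

lemma composition_in:
  "\<lbrakk>f \<in> \<C>; m \<ge> 1; \<And>i. i < arity f \<Longrightarrow> g i \<in> \<C> \<and> arity (g i) = m\<rbrakk> \<Longrightarrow> composition C m f g \<in> \<C>"
  using clone unfolding function_clone_def by blast

sublocale transformation_action C E act
proof
  fix u x assume u: "u \<in> C \<rightarrow>\<^sub>E C" and x: "x \<in> E"
  have "\<xi> (unary_operation C u) \<in> nary_operations E 1"
    using operations_E hom unary_in[OF u] by (metis PiE arity_unary_operation funcset_mem)
  then show "act u x \<in> E"
    using singleton_tuple_in_tuples[of x E] x by (auto simp: act_def nary_operations_def)
next
  fix u v x assume u: "u \<in> C \<rightarrow>\<^sub>E C" and v: "v \<in> C \<rightarrow>\<^sub>E C" and x: "x \<in> E"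
  have "unary_operation C (compose C u v) = composition C 1 (unary_operation C u) (\<lambda>_. unary_operation C v)"
    using v by (auto simp: unary_operation_def composition_def compose_def tuples_def fun_eq_iff PiE_iff)
  then show "act (compose C u v) x = act u (act v x)"
    using app_hom_composition[OF unary_in[OF u], of 1 "singleton_tuple x" "\<lambda>_. unary_operation C v"]
      unary_in[OF v] x by (simp add: act_def)
qed

lemma act_id:
  assumes "x \<in> E"
  shows "act (\<lambda>c\<in>C. c) x = x"
proof -
  have "unary_operation C (\<lambda>c\<in>C. c) = projection C 1 0"
    by (auto simp: unary_operation_def projection_def tuples_def fun_eq_iff PiE_iff)
  then show ?thesis using hom(3)[of 1 0] singleton_tuple_in_tuples[of x E] assms
    by (simp add: act_def projection_def)
qed

lemma act_faithful:
  assumes "u \<in> C \<rightarrow>\<^sub>E C" "v \<in> C \<rightarrow>\<^sub>E C" "\<And>x. x \<in> E \<Longrightarrow> act u x = act v x"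
  shows "u = v"
proof -
  have "\<xi> (unary_operation C w) \<in> nary_operations E 1" if "w \<in> C \<rightarrow>\<^sub>E C" for w
    using operations_E hom unary_in[OF that] by (metis arity_unary_operation funcset_mem)
  then have "\<xi> (unary_operation C u) = \<xi> (unary_operation C v)"
    using assms unfolding act_def by (intro unary_operation_eqI) auto
  moreover have "inj_on \<xi> \<C>" using iso by (simp add: clone_iso_def bij_betw_def)
  ultimately have "unary_operation C u = unary_operation C v"
    using unary_in assms(1,2) by (meson inj_onD)
  then show ?thesis using unary_operation_inject assms(1,2) by blast
qed

lemma app_in: "\<lbrakk>f \<in> \<C>; a \<in> tuples C (arity f)\<rbrakk> \<Longrightarrow> app f a \<in> C"
  using operations_C by (fastforce simp: nary_operations_def PiE_iff)

text \<open>
  For fixed \<open>x\<close>, this says that \<open>a \<mapsto> const a \<cdot> x\<close> is a homomorphism from \<open>f\<close> to its image under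
  \<open>\<xi>\<close>. It is the image under \<open>\<xi>\<close> of the identity that inserting constants into \<open>f\<close> yields the
  constant map with the value of \<open>f\<close>.
\<close>

lemma hom_act_constants:
  assumes f: "f \<in> \<C>" and a: "a \<in> tuples C (arity f)" and x: "x \<in> E"
  shows "app (\<xi> f) (\<lambda>i\<in>{..<arity f}. act (\<lambda>_\<in>C. a i) x) = act (\<lambda>_\<in>C. app f a) x"
proof -
  let ?k = "\<lambda>i. unary_operation C (\<lambda>_\<in>C. a i)"
  have k: "?k i \<in> \<C>" if "i < arity f" for i
    using a that by (intro unary_in) (auto simp: tuples_def)
  have "composition C 1 f ?k = unary_operation C (\<lambda>_\<in>C. app f a)"
  proof (rule unary_operation_eqI)
    show "composition C 1 f ?k \<in> nary_operations C 1"
      using composition_in[OF f, of 1 ?k] k operations_C[of "composition C 1 f ?k"]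
      by (simp add: composition_def)
    show "unary_operation C (\<lambda>_\<in>C. app f a) \<in> nary_operations C 1"
      using app_in[OF f a] by (intro unary_operation_in) auto
    fix c assume c: "c \<in> C"
    have "(\<lambda>i\<in>{..<arity f}. app (?k i) (singleton_tuple c)) = a"
      using a c singleton_tuple_in_tuples[of c C]
      by (auto simp: unary_operation_def tuples_def fun_eq_iff PiE_iff extensional_def)
    then show "app (composition C 1 f ?k) (singleton_tuple c)
        = app (unary_operation C (\<lambda>_\<in>C. app f a)) (singleton_tuple c)"
      using c singleton_tuple_in_tuples[of c C] by (simp add: composition_def unary_operation_def)
  qed
  then show ?thesis
    using app_hom_composition[OF f, of 1 "singleton_tuple x" ?k] k x
    by (simp add: act_def)
qed

text \<open>
  Precomposing \<open>f\<close> in each coordinate \<open>i\<close> with a map \<open>u i\<close> of finite range that fixes \<open>y i\<close> under the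
  action does not change the value of the image at \<open>y\<close>, but makes it depend on \<open>f\<close> only at the finitely
  many tuples with entries in the ranges. Such \<open>u i\<close> exist because \<open>y i\<close> has a finite support.
\<close>

lemma hom_locally_determined:
  assumes "countable C" "countable E" "n \<ge> 1" "y \<in> tuples E n"
  shows "\<exists>A. finite A \<and> A \<subseteq> tuples C n \<and>
       (\<forall>f\<in>\<C>. \<forall>g\<in>\<C>. arity f = n \<and> arity g = n \<and> (\<forall>a\<in>A. app g a = app f a)
          \<longrightarrow> app (\<xi> g) y = app (\<xi> f) y)"
proof -
  have yE: "y i \<in> E" if "i < n" for i using that assms(4) by (auto simp: tuples_def)
  have "\<exists>u. u \<in> C \<rightarrow>\<^sub>E C \<and> finite (u ` C) \<and> act u (y i) = y i" if i: "i < n" for i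
  proof -
    obtain A where A: "finite A" "A \<subseteq> C" "supports A (y i)"
      by (rule finite_support[OF assms(1,2) yE[OF i]])
    obtain u where u: "u \<in> C \<rightarrow>\<^sub>E C" "finite (u ` C)" "\<forall>a\<in>A. u a = a"
      by (rule finite_range_map_fixing[OF A(1,2)])
    have "(\<lambda>c\<in>C. c) \<in> C \<rightarrow>\<^sub>E C" "\<forall>a\<in>A. u a = (\<lambda>c\<in>C. c) a" using u(3) A(2) by auto
    then have "act u (y i) = act (\<lambda>c\<in>C. c) (y i)"
      using A(3) u(1) unfolding supports_def by blast
    then show ?thesis using u(1,2) act_id[OF yE[OF i]] by auto
  qed
  then obtain u where u: "\<And>i. i < n \<Longrightarrow> u i \<in> C \<rightarrow>\<^sub>E C" "\<And>i. i < n \<Longrightarrow> finite (u i ` C)"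
      "\<And>i. i < n \<Longrightarrow> act (u i) (y i) = y i"
    by metis
  define A where "A = (\<Pi>\<^sub>E i\<in>{..<n}. u i ` C)"
  (* w i is the n-ary operation that applies u i to its i-th argument. *)
  define w where "w i = composition C n (unary_operation C (u i)) (\<lambda>_. projection C n i)" for i
  have w: "w i \<in> \<C>" "arity (w i) = n" if "i < n" for i
  proof -
    show "w i \<in> \<C>"
      unfolding w_def using that assms(3) unary_in[OF u(1)] projection_in
      by (intro composition_in) (auto simp: projection_def)
    show "arity (w i) = n" by (simp add: w_def composition_def)
  qed
  have w_app: "app (w i) c = u i (c i)" if "i < n" "c \<in> tuples C n" for i c
    using that by (auto simp: w_def composition_def unary_operation_def projection_def tuples_def PiE_iff)
  have w_hom: "app (\<xi> (w i)) y = y i" if "i < n" for i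
  proof -
    have "app (\<xi> (w i)) y = act (u i) (y i)"
      unfolding w_def act_def
      using app_hom_composition[OF unary_in[OF u(1)[OF that]] assms(3,4), of "\<lambda>_. projection C n i"]
        that assms(3,4) projection_in[OF that] hom(3)[of n i]
      by (simp add: projection_def)
    then show ?thesis using u(3)[OF that] by simp
  qed
  have reduce: "app (\<xi> f) y = app (\<xi> (composition C n f w)) y" if "f \<in> \<C>" "arity f = n" for f
  proof -
    have "(\<lambda>i\<in>{..<n}. app (\<xi> (w i)) y) = y"
      using w_hom assms(4) by (auto simp: tuples_def PiE_iff extensional_def fun_eq_iff)
    then show ?thesis
      using app_hom_composition[OF that(1) assms(3,4), of w] w that(2) by simp
  qed
  have "composition C n f w = composition C n g w"
    if fg: "arity f = n" "arity g = n" "\<forall>a\<in>A. app g a = app f a" for f g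
  proof -
    have "(\<lambda>i\<in>{..<n}. app (w i) c) \<in> A" if "c \<in> tuples C n" for c
      using that w_app[OF _ that] by (auto simp: A_def tuples_def PiE_iff)
    then show ?thesis using fg by (auto simp: composition_def fun_eq_iff)
  qed
  then have "\<forall>f\<in>\<C>. \<forall>g\<in>\<C>. arity f = n \<and> arity g = n \<and> (\<forall>a\<in>A. app g a = app f a)
      \<longrightarrow> app (\<xi> g) y = app (\<xi> f) y"
    using reduce by metis
  moreover have "finite A" unfolding A_def using u(2) by (intro finite_PiE) auto
  moreover have "A \<subseteq> tuples C n"
    using u(1) unfolding A_def tuples_def by (intro PiE_mono) (auto simp: PiE_iff)
  ultimately show ?thesis by blast
qed

text \<open>
  The injection \<open>\<phi>\<close> makes the inverse continuous: the value of an operation at a tuple \<open>a\<close> is read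
  off from the value of its image at the single tuple \<open>\<phi> \<circ> a\<close>. It also makes \<open>C\<close> countable, as is
  needed for finite supports.
\<close>

lemma homeomorphic:
  assumes "countable E" "E \<noteq> {}"
  shows "homeomorphic_map (clone_topology C \<C>) (clone_topology E \<D>) \<xi>"
proof -
  obtain x where x: "x \<in> E" and inj: "inj_on (\<lambda>a. act (\<lambda>_\<in>C. a) x) C"
    by (rule faithful_imp_constants_separated[OF assms(2) act_faithful])
  define \<phi> where "\<phi> a = act (\<lambda>_\<in>C. a) x" for a
  have \<phi>: "inj_on \<phi> C" "\<phi> \<in> C \<rightarrow> E"
    using inj act_closed x by (auto simp: \<phi>_def[abs_def])
  have "countable C"
    using countable_image_inj_on[OF countable_subset[OF _ assms(1)] \<phi>(1)] \<phi>(2) by auto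
  have sub: "\<C> \<subseteq> operations C" "\<D> \<subseteq> operations E"
    using clone clone' by (auto simp: function_clone_def)
  have bij: "bij_betw \<xi> \<C> \<D>" using iso by (simp add: clone_iso_def)
  define \<eta> where "\<eta> = the_inv_into \<C> \<xi>"
  have \<eta>: "\<eta> g \<in> \<C>" "\<xi> (\<eta> g) = g" if "g \<in> \<D>" for g
    using bij that by (auto simp: \<eta>_def bij_betw_def the_inv_into_into f_the_inv_into_f)
  have \<eta>_arity: "arity (\<eta> g) = arity g" if "g \<in> \<D>" for g
    using \<eta>[OF that] hom(2) by metis
  have "continuous_map (clone_topology C \<C>) (clone_topology E \<D>) \<xi>"
    by (rule continuous_map_operationsI[OF sub hom(1,2)
          hom_locally_determined[OF \<open>countable C\<close> assms(1)]])
  moreover have "continuous_map (clone_topology E \<D>) (clone_topology C \<C>) \<eta>"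
  proof (rule continuous_map_operationsI[OF sub(2,1)])
    show "\<eta> \<in> \<D> \<rightarrow> \<C>" using \<eta>(1) by blast
    show "arity (\<eta> g) = arity g" if "g \<in> \<D>" for g by (rule \<eta>_arity[OF that])
    fix n a assume n: "n \<ge> (1::nat)" and a: "a \<in> tuples C n"
    let ?b = "\<lambda>i\<in>{..<n}. \<phi> (a i)"
    have *: "app g ?b = \<phi> (app (\<eta> g) a)" "app (\<eta> g) a \<in> C" if "g \<in> \<D>" "arity g = n" for g
      using hom_act_constants[OF \<eta>(1)[OF that(1)] _ x, of a] app_in[OF \<eta>(1)[OF that(1)], of a]
        a \<eta>(2) \<eta>_arity that by (simp_all add: \<phi>_def)
    have "{?b} \<subseteq> tuples E n"
      using a \<phi>(2) by (auto simp: tuples_def PiE_iff)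
    moreover have "app (\<eta> h) a = app (\<eta> g) a"
      if "g \<in> \<D>" "h \<in> \<D>" "arity g = n \<and> arity h = n \<and> (\<forall>b\<in>{?b}. app h b = app g b)" for g h
    proof -
      have "\<phi> (app (\<eta> h) a) = \<phi> (app (\<eta> g) a)"
        using that *(1)[of g] *(1)[of h] by simp
      then show ?thesis
        using that *(2)[of g] *(2)[of h] \<phi>(1) by (blast dest: inj_onD)
    qed
    ultimately show "\<exists>A. finite A \<and> A \<subseteq> tuples E n \<and>
        (\<forall>g\<in>\<D>. \<forall>h\<in>\<D>. arity g = n \<and> arity h = n \<and> (\<forall>b\<in>A. app h b = app g b)
           \<longrightarrow> app (\<eta> h) a = app (\<eta> g) a)"
      by (intro exI[of _ "{?b}"] conjI ballI impI) blast+
  qed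
  moreover have "topspace (clone_topology C \<C>) = \<C>" "topspace (clone_topology E \<D>) = \<D>"
    using sub by (auto simp: clone_topology_def)
  ultimately have "homeomorphic_maps (clone_topology C \<C>) (clone_topology E \<D>) \<xi> \<eta>"
    using bij by (auto simp: homeomorphic_maps_def \<eta>_def bij_betw_def the_inv_into_f_f f_the_inv_into_f)
  then show ?thesis by (rule homeomorphic_maps_imp_map)
qed

end

theorem clone_with_all_unary_automatic_homeomorphicity:
  assumes "function_clone C \<C>" "nary_operations C 1 \<subseteq> \<C>" "countable E" "E \<noteq> {}"
  shows "clone_automatic_homeomorphicity E C \<C>"
  unfolding clone_automatic_homeomorphicity_def
proof (intro allI impI, elim conjE)
  fix \<D> \<xi> assume "closed_function_clone E \<D>" "clone_iso C \<C> E \<D> \<xi>"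
  then interpret full_clone_iso C \<C> E \<D> \<xi>
    using assms(1,2) by unfold_locales (auto simp: closed_function_clone_def)
  show "homeomorphic_map (clone_topology C \<C>) (clone_topology E \<D>) \<xi>"
    by (rule homeomorphic[OF assms(3,4)])
qed

lemma function_clone_operations: "function_clone D (operations D)"
  unfolding function_clone_def
proof (intro conjI allI impI ballI)
  show "projection D n k \<in> operations D" if "n \<ge> 1" "k < n" for n k
    using that by (auto simp: operations_def nary_operations_def projection_def tuples_def PiE_iff)
  fix f m g assume f: "f \<in> operations D" and m: "m \<ge> (1::nat)"
    and g: "\<forall>i<arity f. g i \<in> operations D \<and> arity (g i) = m"
  have "app (g i) x \<in> D" if "i < arity f" "x \<in> tuples D m" for i x
    using that g operation_cases(2)[of "g i" D] by (auto simp: nary_operations_def PiE_iff)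
  then have "(\<lambda>i\<in>{..<arity f}. app (g i) x) \<in> tuples D (arity f)" if "x \<in> tuples D m" for x
    using that by (auto simp: tuples_def)
  moreover have "app f \<in> tuples D (arity f) \<rightarrow>\<^sub>E D"
    using operation_cases(2)[OF f] by (auto simp: nary_operations_def)
  ultimately have "composition D m f g \<in> nary_operations D m"
    by (auto simp: composition_def nary_operations_def PiE_iff)
  then show "composition D m f g \<in> operations D" using m by (auto simp: operations_def)
qed auto

section \<open>The transformation monoid\<close>

text \<open>
  Here the isomorphism itself is the action: supports give its continuity, and the copy of the
  natural action on the orbit of constants gives that of the inverse.
\<close>

theorem transformation_monoid_automatic_homeomorphicity:
  fixes D :: "'d set" and E :: "'e set"
  assumes "countable E" "E \<noteq> {}"
  shows "monoid_automatic_homeomorphicity E D (carrier (transformation_monoid D))"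
  unfolding monoid_automatic_homeomorphicity_def
proof (intro allI impI ballI)
  fix N \<xi>
  assume N: "closed_transformation_monoid E N"
    and \<xi>: "\<xi> \<in> iso (transformation_monoid D\<lparr>carrier := carrier (transformation_monoid D)\<rparr>)
                (transformation_monoid E\<lparr>carrier := N\<rparr>)"
  let ?M = "D \<rightarrow>\<^sub>E D"
  have M: "carrier (transformation_monoid D) = ?M" by (simp add: transformation_monoid_def)
  have NE: "N \<subseteq> E \<rightarrow>\<^sub>E E"
    using N submonoid.subset[of N "transformation_monoid E"]
    by (simp add: closed_transformation_monoid_def transformation_monoid_def)
  have into: "\<xi> \<in> ?M \<rightarrow> N" and bij: "bij_betw \<xi> ?M N"
    using \<xi> by (auto simp: iso_def hom_def transformation_monoid_def)
  have mult: "\<xi> (compose D u v) = compose E (\<xi> u) (\<xi> v)" if "u \<in> ?M" "v \<in> ?M" for u v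
    using \<xi> that by (auto simp: iso_def hom_def transformation_monoid_def)
  have \<xi>E: "\<xi> u \<in> E \<rightarrow>\<^sub>E E" if "u \<in> ?M" for u using that into NE by blast
  interpret transformation_action D E \<xi>
    by unfold_locales (use \<xi>E mult in \<open>auto simp: compose_def PiE_iff\<close>)
  obtain x where x: "x \<in> E" and inj: "inj_on (\<lambda>a. \<xi> (\<lambda>_\<in>D. a) x) D"
  proof (rule faithful_imp_constants_separated[OF assms(2)])
    fix u v assume uv: "u \<in> ?M" "v \<in> ?M" "\<And>x. x \<in> E \<Longrightarrow> \<xi> u x = \<xi> v x"
    then have "\<xi> u = \<xi> v" using \<xi>E by (metis PiE_ext)
    then show "u = v" using bij uv(1,2) by (meson bij_betw_def inj_onD)
  qed
  define \<phi> where "\<phi> a = \<xi> (\<lambda>_\<in>D. a) x" for a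
  have \<phi>: "inj_on \<phi> D" "\<phi> \<in> D \<rightarrow> E"
    using inj act_closed x by (auto simp: \<phi>_def[abs_def])
  have equivariant: "\<xi> u (\<phi> a) = \<phi> (u a)" if "u \<in> ?M" "a \<in> D" for u a
  proof -
    have "compose D u (\<lambda>_\<in>D. a) = (\<lambda>_\<in>D. u a)" using that by (auto simp: compose_def)
    then show ?thesis using act_compose[OF that(1) _ x, of "\<lambda>_\<in>D. a"] that(2) by (simp add: \<phi>_def)
  qed
  have "countable D"
    using countable_image_inj_on[OF countable_subset[OF _ assms(1)] \<phi>(1)] \<phi>(2) by auto
  define \<eta> where "\<eta> = the_inv_into ?M \<xi>"
  have \<eta>: "\<eta> g \<in> ?M" "\<xi> (\<eta> g) = g" if "g \<in> N" for g
    using bij that the_inv_into_into[of \<xi> ?M g ?M] f_the_inv_into_f[of \<xi> ?M g]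
    by (auto simp: \<eta>_def bij_betw_def)
  let ?X = "subtopology (transformation_topology D) ?M"
  let ?Y = "subtopology (transformation_topology E) N"
  have "continuous_map ?X ?Y \<xi>"
  proof (rule continuous_map_transformationsI[OF subset_refl NE into])
    fix y assume "y \<in> E"
    then obtain A where "finite A" "A \<subseteq> D" "supports A y"
      using finite_support[OF \<open>countable D\<close> assms(1)] by blast
    then show "\<exists>A. finite A \<and> A \<subseteq> D \<and>
        (\<forall>f\<in>?M. \<forall>g\<in>?M. (\<forall>a\<in>A. g a = f a) \<longrightarrow> \<xi> g y = \<xi> f y)"
      unfolding supports_def by (intro exI[of _ A] conjI ballI impI) blast+
  qed
  moreover have "continuous_map ?Y ?X \<eta>"
  proof (rule continuous_map_transformationsI[OF NE subset_refl])
    show "\<eta> \<in> N \<rightarrow> ?M" using \<eta>(1) by blast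
    fix a assume a: "a \<in> D"
    have "\<eta> h a = \<eta> g a" if "g \<in> N" "h \<in> N" "h (\<phi> a) = g (\<phi> a)" for g h
    proof -
      have "\<phi> (\<eta> h a) = \<phi> (\<eta> g a)"
        using equivariant[OF \<eta>(1) a] \<eta>(2) that by metis
      moreover have "\<eta> h a \<in> D" "\<eta> g a \<in> D" using \<eta>(1) that a by blast+
      ultimately show ?thesis using \<phi>(1) by (meson inj_onD)
    qed
    moreover have "{\<phi> a} \<subseteq> E" using \<phi>(2) a by blast
    ultimately show "\<exists>A. finite A \<and> A \<subseteq> E \<and>
        (\<forall>g\<in>N. \<forall>h\<in>N. (\<forall>b\<in>A. h b = g b) \<longrightarrow> \<eta> h a = \<eta> g a)"
      by (intro exI[of _ "{\<phi> a}"] conjI ballI impI) blast+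
  qed
  moreover have "topspace ?X = ?M" "topspace ?Y = N"
    using NE by (auto simp: transformation_topology_def)
  ultimately have "homeomorphic_maps ?X ?Y \<xi> \<eta>"
    using bij \<eta>(2) by (auto simp: homeomorphic_maps_def \<eta>_def bij_betw_def the_inv_into_f_f)
  then show "homeomorphic_map (subtopology (transformation_topology D) (carrier (transformation_monoid D))) ?Y \<xi>"
    unfolding M by (rule homeomorphic_maps_imp_map)
qed

theorem corollary28:
  fixes C :: "'c set" and D :: "'d set" and E :: "'e set"
  assumes "countable D" and "infinite D" and "countable E" and "infinite E"
  shows "(\<forall>\<C>. closed_function_clone C \<C> \<and> nary_operations C 1 \<subseteq> \<C> \<longrightarrow>
             clone_automatic_homeomorphicity E C \<C>) \<and>
         clone_automatic_homeomorphicity E D (operations D) \<and>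
         monoid_automatic_homeomorphicity E D (carrier (transformation_monoid D))"
proof -
  have E: "E \<noteq> {}" using assms(4) by auto
  have "nary_operations D 1 \<subseteq> operations D" by (auto simp: operations_def)
  then have "clone_automatic_homeomorphicity E D (operations D)"
    by (rule clone_with_all_unary_automatic_homeomorphicity[OF function_clone_operations _ assms(3) E])
  moreover have "clone_automatic_homeomorphicity E C \<C>"
    if "closed_function_clone C \<C>" "nary_operations C 1 \<subseteq> \<C>" for \<C>
    using that clone_with_all_unary_automatic_homeomorphicity[OF _ that(2) assms(3) E]
    by (simp add: closed_function_clone_def)
  ultimately show ?thesis
    using transformation_monoid_automatic_homeomorphicity[OF assms(3) E, of D] by blast
qed

end
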